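(* Let $\mathcal{H}=(H_1,\dots,H_p)$ where $H_1,\dots,H_p$ are (affine) hyperplanes of $\mathbb{R}^n$ with nonempty intersection $S_{\mathcal{H}}:=\bigcap_{i=1}^p H_i$, let $C_{\mathcal{H}}$ be the circumcentered-reflection (CRM) operator regarding $\mathcal{H}$, and let $z\in\mathbb{R}^n$ be given. Then CRM finds the projection of $z$ onto $S_{\mathcal{H}}$ in one single step, with eventual use of $z_{REP}$. That is: the replacement procedure described in the context can be carried out from $z$ and stops after finitely many replacements at a point $z_{REP}$ (with $z_{REP}=z$ if $R_{H_i}\cdots R_{H_2}R_{H_1}(z)\notin H_i$ for all $i=1,\dots,p$), and $$C_{\mathcal{H}}(z_{REP})=P_{S_{\mathcal{H}}}(z).$$
   Context: $\|\cdot\|$ is the Euclidean norm. For a nonempty affine subspace $U$ of $\mathbb{R}^n$, $P_U$ is the orthogonal projection onto $U$ and $R_U:=2P_U-\mathrm{Id}$ the reflection onto $U$. For an affine hyperplane $H$, let $\hat H=H-H$ be its direction subspace and $\hat R_H:=R_{\hat H}$ the (linear) reflection onto $\hat H$ (so $\hat R_H=R_H$ if $H$ is a linear subspace). CRM operator: for $z\in\mathbb{R}^n$, $C_{\mathcal{H}}(z)$ is the point (known to exist and be unique because $S_{\mathcal{H}}\neq\varnothing$) such that $C_{\mathcal{H}}(z)\in\mathrm{aff}\{z,R_{H_1}(z),R_{H_2}R_{H_1}(z),\dots,R_{H_p}\cdots R_{H_2}R_{H_1}(z)\}$ and $\|z-C_{\mathcal{H}}(z)\|=\|R_{H_1}(z)-C_{\mathcal{H}}(z)\|=\cdots=\|R_{H_p}\cdots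 R_{H_2}R_{H_1}(z)-C_{\mathcal{H}}(z)\|$. Replacement procedure. Start with $w=z$. If $R_{H_i}\cdots R_{H_2}R_{H_1}(w)\notin H_i$ for all $i=1,\dots,p$, stop and set $z_{REP}:=w$. Otherwise let $\check\imath$ be the smallest index with $R_{H_{\check\imath}}\cdots R_{H_1}(w)\in H_{\check\imath}$, let $\check a\ne0$ be any vector orthogonal to $\hat H_{\check\imath}$, and replace $w$ by $w_{rep}:=w+t\,\hat R_{H_1}\hat R_{H_2}\cdots\hat R_{H_{\check\imath}}(\check a)$, where $t\neq0$ is a real number close enough to zero that $R_{H_i}\cdots R_{H_2}R_{H_1}(w_{rep})\notin H_i$ for all $i=1,\dots,\check\imath$. Repeat with the new $w$. *)

theory Defs
  imports "HOL-Analysis.Analysis"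
begin

text \<open>
  A tuple of hyperplanes \<open>(H\<^sub>1, \<dots>, H\<^sub>p)\<close> is given by a function \<open>H\<close> on \<^typ>\<open>nat\<close> and the number
  \<open>p\<close>; only the values on \<open>{1..p}\<close> matter.
\<close>

definition hyperplane :: "'a::euclidean_space set \<Rightarrow> bool" where
  "hyperplane U \<longleftrightarrow> (\<exists>a b. a \<noteq> 0 \<and> U = {x. a \<bullet> x = b})"

definition direction :: "'a::euclidean_space set \<Rightarrow> 'a set" where
  "direction U = {x - y | x y. x \<in> U \<and> y \<in> U}"

text \<open>
  On a nonempty affine subspace (closed and convex, as the dimension is finite),
  \<^const>\<open>closest_point\<close> is the orthogonal projection; see \<open>closest_point_affine_orthogonal\<close> below.
\<close>

definition reflection :: "'a::euclidean_space set \<Rightarrow> 'a \<Rightarrow> 'a" where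
  "reflection U x = 2 *\<^sub>R closest_point U x - x"

text \<open>\<open>reflections H i\<close> is \<open>R\<^bsub>H i\<^esub> \<circ> \<dots> \<circ> R\<^bsub>H 2\<^esub> \<circ> R\<^bsub>H 1\<^esub>\<close>, the identity for \<open>i = 0\<close>.\<close>

primrec reflections :: "(nat \<Rightarrow> 'a::euclidean_space set) \<Rightarrow> nat \<Rightarrow> 'a \<Rightarrow> 'a" where
  "reflections H 0 z = z"
| "reflections H (Suc i) z = reflection (H (Suc i)) (reflections H i z)"

text \<open>
  The linear reflections composed in the opposite order: \<open>rev_linear_reflections H i\<close> is
  \<open>R\<^bsub>direction (H 1)\<^esub> \<circ> R\<^bsub>direction (H 2)\<^esub> \<circ> \<dots> \<circ> R\<^bsub>direction (H i)\<^esub>\<close>.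
\<close>

primrec rev_linear_reflections :: "(nat \<Rightarrow> 'a::euclidean_space set) \<Rightarrow> nat \<Rightarrow> 'a \<Rightarrow> 'a" where
  "rev_linear_reflections H 0 v = v"
| "rev_linear_reflections H (Suc i) v =
     rev_linear_reflections H i (reflection (direction (H (Suc i))) v)"

definition is_circumcenter ::
    "(nat \<Rightarrow> 'a::euclidean_space set) \<Rightarrow> nat \<Rightarrow> 'a \<Rightarrow> 'a \<Rightarrow> bool" where
  "is_circumcenter H p z c \<longleftrightarrow>
     c \<in> affine hull ((\<lambda>i. reflections H i z) ` {0..p}) \<and>
     (\<forall>i\<in>{1..p}. norm (z - c) = norm (reflections H i z - c))"

text \<open>If the hyperplanes have a common point, this is well defined for every \<open>z\<close>; see \<open>ex1_circumcenter\<close> below.\<close>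

definition crm :: "(nat \<Rightarrow> 'a::euclidean_space set) \<Rightarrow> nat \<Rightarrow> 'a \<Rightarrow> 'a" where
  "crm H p z = (THE c. is_circumcenter H p z c)"

definition nondegenerate_upto ::
    "(nat \<Rightarrow> 'a::euclidean_space set) \<Rightarrow> nat \<Rightarrow> 'a \<Rightarrow> bool" where
  "nondegenerate_upto H k w \<longleftrightarrow> (\<forall>i\<in>{1..k}. reflections H i w \<notin> H i)"

definition first_degenerate ::
    "(nat \<Rightarrow> 'a::euclidean_space set) \<Rightarrow> nat \<Rightarrow> 'a \<Rightarrow> nat \<Rightarrow> bool" where
  "first_degenerate H p w k \<longleftrightarrow>
     k \<in> {1..p} \<and> reflections H k w \<in> H k \<and> (\<forall>i\<in>{1..<k}. reflections H i w \<notin> H i)"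

definition normal_vector :: "'a::euclidean_space set \<Rightarrow> 'a \<Rightarrow> bool" where
  "normal_vector U a \<longleftrightarrow> a \<noteq> 0 \<and> (\<forall>v\<in>direction U. orthogonal a v)"

definition replacement ::
    "(nat \<Rightarrow> 'a::euclidean_space set) \<Rightarrow> nat \<Rightarrow> 'a \<Rightarrow> 'a \<Rightarrow> real \<Rightarrow> 'a" where
  "replacement H k w a t = w + t *\<^sub>R rev_linear_reflections H k a"

text \<open>
  The procedure leaves the normal vector and the scalar \<open>t\<close> free, so a single replacement is a
  relation.  Every nonzero \<open>t\<close> whose replacement is nondegenerate up to the current index is
  admitted, whatever its size.
\<close>

definition replacement_step ::
    "(nat \<Rightarrow> 'a::euclidean_space set) \<Rightarrow> nat \<Rightarrow> 'a \<Rightarrow> 'a \<Rightarrow> bool" where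
  "replacement_step H p w w' \<longleftrightarrow>
     (\<exists>k a t. first_degenerate H p w k \<and> normal_vector (H k) a \<and> t \<noteq> 0 \<and>
        w' = replacement H k w a t \<and> nondegenerate_upto H k w')"

text \<open>\<open>zrep\<close> is a possible final point of a run of the procedure started at \<open>z\<close>.\<close>

definition is_zrep ::
    "(nat \<Rightarrow> 'a::euclidean_space set) \<Rightarrow> nat \<Rightarrow> 'a \<Rightarrow> 'a \<Rightarrow> bool" where
  "is_zrep H p z zrep \<longleftrightarrow>
     (replacement_step H p)\<^sup>*\<^sup>* z zrep \<and> nondegenerate_upto H p zrep"

lemma closest_point_affine_orthogonal:
  fixes U :: "'a::euclidean_space set"
  assumes "affine U" "u \<in> U"
  shows "(x - closest_point U x) \<bullet> (u - closest_point U x) = 0"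
proof -
  let ?c = "closest_point U x"
  have cl: "closed U" and cv: "convex U"
    using assms by (auto intro: affine_closed affine_imp_convex)
  have c: "?c \<in> U" using closest_point_in_set[OF cl] assms by auto
  have "2 *\<^sub>R ?c + (-1) *\<^sub>R u \<in> U"
    by (rule mem_affine[OF assms(1) c assms(2)]) simp
  then have "(x - ?c) \<bullet> ((2 *\<^sub>R ?c + (-1) *\<^sub>R u) - ?c) \<le> 0"
    using closest_point_dot[OF cv cl] by blast
  moreover have "(2 *\<^sub>R ?c + (-1) *\<^sub>R u) - ?c = - (u - ?c)"
    by (simp add: scaleR_2)
  moreover have "(x - ?c) \<bullet> (u - ?c) \<le> 0"
    using closest_point_dot[OF cv cl assms(2)] by blast
  ultimately show ?thesis
    by (metis inner_minus_right neg_le_0_iff_le order_antisym)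
qed

lemma affine_hyperplane_set: "hyperplane U \<Longrightarrow> affine U"
  unfolding hyperplane_def using affine_hyperplane by blast

lemma norm_reflection_diff:
  fixes U :: "'a::euclidean_space set"
  assumes "affine U" "s \<in> U"
  shows "norm (reflection U x - s) = norm (x - s)"
proof -
  let ?c = "closest_point U x"
  have "(x - ?c) \<bullet> (s - ?c) = 0"
    by (rule closest_point_affine_orthogonal[OF assms])
  then have "(reflection U x - s) \<bullet> (reflection U x - s) = (x - s) \<bullet> (x - s)"
    by (simp add: reflection_def inner_diff_left inner_diff_right inner_commute algebra_simps)
  then show ?thesis by (simp add: norm_eq_sqrt_inner)
qed

lemma norm_reflections_diff:
  fixes H :: "nat \<Rightarrow> 'a::euclidean_space set"
  assumes "\<And>i. i \<in> {1..p} \<Longrightarrow> hyperplane (H i)" "s \<in> (\<Inter>i\<in>{1..p}. H i)" "i \<le> p"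
  shows "norm (reflections H i z - s) = norm (z - s)"
  using assms(3)
proof (induction i)
  case (Suc i)
  then have "Suc i \<in> {1..p}" by simp
  then have "affine (H (Suc i))" "s \<in> H (Suc i)"
    using assms(1,2) affine_hyperplane_set by blast+
  then show ?case using Suc by (simp add: norm_reflection_diff)
qed simp

lemma ex1_circumcenter:
  fixes H :: "nat \<Rightarrow> 'a::euclidean_space set"
  assumes hyp: "\<And>i. i \<in> {1..p} \<Longrightarrow> hyperplane (H i)" and ne: "(\<Inter>i\<in>{1..p}. H i) \<noteq> {}"
  shows "\<exists>!c. is_circumcenter H p z c"
proof (rule ex_ex1I)
  let ?X = "(\<lambda>i. reflections H i z) ` {0..p}"
  obtain s where s: "s \<in> (\<Inter>i\<in>{1..p}. H i)" using ne by auto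
  let ?c = "closest_point (affine hull ?X) s"
  have zX: "z \<in> ?X" by (rule image_eqI[of _ _ 0]) auto
  then have zA: "z \<in> affine hull ?X" by (rule hull_inc)
  then have cA: "?c \<in> affine hull ?X"
    using closest_point_in_set[of "affine hull ?X" s] affine_closed[OF affine_affine_hull] by auto
  have pyth: "(norm (x - ?c))\<^sup>2 = (norm (x - s))\<^sup>2 - (norm (s - ?c))\<^sup>2" if "x \<in> affine hull ?X" for x
  proof -
    have "(s - ?c) \<bullet> (x - ?c) = 0"
      using that by (intro closest_point_affine_orthogonal) auto
    then show ?thesis
      unfolding power2_norm_eq_inner
      by (simp add: inner_diff_left inner_diff_right inner_commute algebra_simps)
  qed
  have "norm (z - ?c) = norm (reflections H i z - ?c)" if i: "i \<in> {1..p}" for i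
  proof -
    have "reflections H i z \<in> affine hull ?X"
      using i by (intro hull_inc image_eqI[of _ _ i]) auto
    moreover have "norm (reflections H i z - s) = norm (z - s)"
      using norm_reflections_diff[OF hyp s] i by simp
    ultimately have "(norm (z - ?c))\<^sup>2 = (norm (reflections H i z - ?c))\<^sup>2"
      using pyth zA by metis
    then show ?thesis by simp
  qed
  then show "\<exists>c. is_circumcenter H p z c"
    unfolding is_circumcenter_def using cA by blast
next
  let ?X = "(\<lambda>i. reflections H i z) ` {0..p}"
  fix c d assume cd: "is_circumcenter H p z c" "is_circumcenter H p z d"
  let ?B = "{x. (c - d) \<bullet> x = (c - d) \<bullet> z}"
  have "(c - d) \<bullet> x = (c - d) \<bullet> z" if "x \<in> ?X" for x
  proof -
    have "norm (z - e) = norm (x - e)" if "e = c \<or> e = d" for e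
    proof -
      obtain i where i: "i \<le> p" "x = reflections H i z" using \<open>x \<in> ?X\<close> by auto
      show ?thesis
      proof (cases "i = 0")
        case False
        then show ?thesis using i cd that unfolding is_circumcenter_def by force
      qed (use i in simp)
    qed
    then have "(z - c) \<bullet> (z - c) = (x - c) \<bullet> (x - c)" "(z - d) \<bullet> (z - d) = (x - d) \<bullet> (x - d)"
      by (simp_all flip: power2_norm_eq_inner)
    then show ?thesis
      by (simp add: inner_diff_left inner_diff_right inner_commute algebra_simps)
  qed
  then have "affine hull ?X \<subseteq> ?B"
    by (intro hull_minimal affine_hyperplane) blast
  then have "c \<in> ?B" "d \<in> ?B"
    using cd unfolding is_circumcenter_def by blast+
  then have "(c - d) \<bullet> c = (c - d) \<bullet> d" by simp
  then have "(c - d) \<bullet> (c - d) = 0" by (simp add: inner_diff_right)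
  then show "c = d" by simp
qed

end

theory Submission
  imports Defs
begin

text \<open>
  Let \<open>a i\<close> be a normal of \<open>H i\<close> and let \<open>N\<close> be the span of all these normals, the orthogonal
  complement of the direction of the intersection \<open>S\<close>.

  \<^emph>\<open>One step suffices.\<close>  If no iterated reflection of \<open>w\<close> lies on its mirror, then consecutive
  reflections of \<open>w\<close> differ by \<^emph>\<open>nonzero\<close> multiples of the normals, so the affine hull of the
  reflections is all of \<open>w + N\<close> (\<open>affine_hull_reflections\<close>).  This affine space contains the
  projection \<open>c\<close> of \<open>w\<close> onto \<open>S\<close> (\<open>projection_in_normal_translate\<close>), and since reflections in the
  \<open>H i\<close> preserve the distance to every point of \<open>S\<close>, the point \<open>c\<close> is equidistant from all of them.
  Hence \<open>c\<close> is the circumcenter (\<open>crm_nondegenerate\<close>).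

  \<^emph>\<open>Replacing is harmless.\<close>  A replacement moves \<open>w\<close> by a vector of \<open>N\<close>, because a linear
  reflection changes a vector by a multiple of a normal.  So it does not change the projection onto
  \<open>S\<close> (\<open>closest_point_Inter\<close>, \<open>zrep_diff_in_normal_span\<close>).

  \<^emph>\<open>Replacing is possible and terminates.\<close>  The composition of linear reflections in the
  displacement is chosen such that, after \<open>k\<close> reflections, the displaced point has moved by exactly
  \<open>t\<close> times a normal of \<open>H k\<close>; it therefore leaves \<open>H k\<close> for each \<open>t \<noteq> 0\<close>, while the reflections
  with smaller index, which depend continuously on \<open>t\<close>, stay off their mirrors for small \<open>t\<close>
  (\<open>eventually_nondegenerate_replacement\<close>).  The first degenerate index thus grows with each
  replacement, and it is bounded by \<open>p\<close>.
\<close>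

section \<open>A single hyperplane\<close>

lemma closest_point_affine_eqI:
  fixes U :: "'a::euclidean_space set"
  assumes "affine U" "c \<in> U" "\<And>y. y \<in> U \<Longrightarrow> (x - c) \<bullet> (y - c) = 0"
  shows "closest_point U x = c"
proof -
  let ?d = "closest_point U x"
  have "closed U" using assms(1) by (rule affine_closed)
  then have "?d \<in> U" using assms(2) closest_point_in_set by blast
  then have "(x - c) \<bullet> (?d - c) = 0" by (rule assms(3))
  moreover have "(x - ?d) \<bullet> (c - ?d) = 0"
    using assms(1,2) by (rule closest_point_affine_orthogonal)
  ultimately have "(?d - c) \<bullet> (?d - c) = 0"
    by (simp add: inner_diff_left inner_diff_right inner_commute algebra_simps)
  then show ?thesis by simp
qed

lemma reflection_hyperplane:
  fixes a :: "'a::euclidean_space"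
  assumes "a \<noteq> 0"
  shows "reflection {y. a \<bullet> y = b} x = x - (2 * (a \<bullet> x - b) / (a \<bullet> a)) *\<^sub>R a"
proof -
  define q where "q = (a \<bullet> x - b) / (a \<bullet> a)"
  let ?c = "x - q *\<^sub>R a"
  have "closest_point {y. a \<bullet> y = b} x = ?c"
  proof (rule closest_point_affine_eqI)
    show c: "?c \<in> {y. a \<bullet> y = b}"
      using assms by (simp add: q_def inner_diff_right)
    fix y assume "y \<in> {y. a \<bullet> y = b}"
    with c have "a \<bullet> (y - ?c) = 0" by (simp add: inner_diff_right)
    then show "(x - ?c) \<bullet> (y - ?c) = 0" by simp
  qed (rule affine_hyperplane)
  moreover have "2 *\<^sub>R ?c - x = x - (2 * q) *\<^sub>R a"
    by (simp add: scaleR_2 scaleR_diff_right)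
  ultimately show ?thesis
    by (simp add: reflection_def q_def)
qed

lemma direction_hyperplane:
  fixes a :: "'a::euclidean_space"
  assumes "a \<noteq> 0"
  shows "direction {y. a \<bullet> y = b} = {y. a \<bullet> y = 0}"
proof
  show "direction {y. a \<bullet> y = b} \<subseteq> {y. a \<bullet> y = 0}"
    by (auto simp: direction_def inner_diff_right)
  show "{y. a \<bullet> y = 0} \<subseteq> direction {y. a \<bullet> y = b}"
  proof
    fix v assume v: "v \<in> {y. a \<bullet> y = 0}"
    let ?u = "(b / (a \<bullet> a)) *\<^sub>R a"
    have "v = (?u + v) - ?u" "a \<bullet> (?u + v) = b" "a \<bullet> ?u = b"
      using v assms by (simp_all add: inner_add_right)
    then show "v \<in> direction {y. a \<bullet> y = b}" unfolding direction_def by blast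
  qed
qed

lemma normal_vector_hyperplane:
  fixes a :: "'a::euclidean_space"
  assumes "a \<noteq> 0" "normal_vector {y. a \<bullet> y = b} v"
  shows "\<exists>r. r \<noteq> 0 \<and> v = r *\<^sub>R a"
proof -
  let ?r = "(a \<bullet> v) / (a \<bullet> a)"
  let ?u = "v - ?r *\<^sub>R a"
  have u: "a \<bullet> ?u = 0" using assms(1) by (simp add: inner_diff_right)
  then have "v \<bullet> ?u = 0"
    using assms unfolding normal_vector_def direction_hyperplane[OF assms(1)] orthogonal_def by blast
  with u have "?u \<bullet> ?u = 0" by (simp add: inner_diff_left)
  then have "v = ?r *\<^sub>R a" by simp
  moreover have "v \<noteq> 0" using assms(2) by (simp add: normal_vector_def)
  ultimately show ?thesis by (metis scaleR_zero_left)
qed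

section \<open>Iterated reflections in a family of hyperplanes\<close>

locale hyperplane_family =
  fixes H :: "nat \<Rightarrow> 'a::euclidean_space set" and p :: nat
    and a :: "nat \<Rightarrow> 'a" and b :: "nat \<Rightarrow> real"
  assumes normal_nonzero: "i \<in> {1..p} \<Longrightarrow> a i \<noteq> 0"
    and hyperplane_eq: "i \<in> {1..p} \<Longrightarrow> H i = {x. a i \<bullet> x = b i}"
begin

definition normal_span :: "'a set" where
  "normal_span = span (a ` {1..p})"

lemma subspace_normal_span: "subspace normal_span"
  by (simp add: normal_span_def)

lemma normal_in_normal_span: "i \<in> {1..p} \<Longrightarrow> a i \<in> normal_span"
  unfolding normal_span_def by (rule span_base) blast

lemma reflection_H:
  assumes "i \<in> {1..p}"
  shows "reflection (H i) x = x - (2 * (a i \<bullet> x - b i) / (a i \<bullet> a i)) *\<^sub>R a i"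
  using reflection_hyperplane[OF normal_nonzero[OF assms]] hyperplane_eq[OF assms] by simp

lemma reflection_direction:
  assumes "i \<in> {1..p}"
  shows "reflection (direction (H i)) v = v - (2 * (a i \<bullet> v) / (a i \<bullet> a i)) *\<^sub>R a i"
  using reflection_hyperplane[OF normal_nonzero[OF assms], where b = 0]
    direction_hyperplane[OF normal_nonzero[OF assms]] hyperplane_eq[OF assms] by simp

lemma reflection_direction_involution:
  assumes "i \<in> {1..p}"
  shows "reflection (direction (H i)) (reflection (direction (H i)) v) = v"
  using normal_nonzero[OF assms] by (simp add: reflection_direction[OF assms] inner_diff_right)

lemma reflection_in_H_iff:
  assumes "i \<in> {1..p}"
  shows "reflection (H i) x \<in> H i \<longleftrightarrow> a i \<bullet> x = b i"
proof -
  have "reflection (H i) x \<in> H i \<longleftrightarrow> a i \<bullet> reflection (H i) x = b i"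
    using hyperplane_eq[OF assms] by blast
  also have "\<dots> \<longleftrightarrow> a i \<bullet> x = b i"
    using normal_nonzero[OF assms] by (auto simp: reflection_H[OF assms] inner_diff_right)
  finally show ?thesis .
qed

text \<open>
  Each reflection is an affine map whose linear part is the reflection in the direction, and the
  linear part of a composition is the composition of the linear parts.
\<close>

lemma reflections_displaced:
  assumes "k \<le> p"
  shows "reflections H k (w + t *\<^sub>R d) =
    reflections H k w + t *\<^sub>R reflections (\<lambda>i. direction (H i)) k d"
  using assms
proof (induction k)
  case (Suc k)
  then have k: "Suc k \<in> {1..p}" by simp
  have lin: "reflection (H (Suc k)) (x + t *\<^sub>R v) =
      reflection (H (Suc k)) x + t *\<^sub>R reflection (direction (H (Suc k))) v" for x v
    unfolding reflection_H[OF k] reflection_direction[OF k]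
    by (simp add: inner_add_right scaleR_diff_right add_divide_distrib diff_divide_distrib algebra_simps)
  show ?case using Suc lin by simp
qed simp

text \<open>
  Linear reflections are involutions, so composing them in the opposite order gives the inverse.
  This is why a replacement uses \<open>rev_linear_reflections\<close>: the displacement becomes exactly \<open>v\<close>
  after \<open>k\<close> reflections.
\<close>

lemma reflections_rev_linear_reflections:
  assumes "k \<le> p"
  shows "reflections (\<lambda>i. direction (H i)) k (rev_linear_reflections H k v) = v"
  using assms
proof (induction k arbitrary: v)
  case (Suc k)
  then show ?case using reflection_direction_involution[of "Suc k"] by simp
qed simp

lemma rev_linear_reflections_in_normal_span:
  assumes "k \<le> p" "v \<in> normal_span"
  shows "rev_linear_reflections H k v \<in> normal_span"
  using assms
proof (induction k arbitrary: v)
  case (Suc k)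
  then have k: "Suc k \<in> {1..p}" by simp
  have "reflection (direction (H (Suc k))) v \<in> normal_span"
    unfolding reflection_direction[OF k]
    by (intro subspace_diff subspace_scale subspace_normal_span normal_in_normal_span k Suc.prems)
  then show ?case using Suc by simp
qed simp

section \<open>The circumcenter at a nondegenerate point\<close>

lemma affine_Inter_H: "affine (\<Inter>i\<in>{1..p}. H i)"
proof (rule affine_Inter)
  fix U assume "U \<in> H ` {1..p}"
  then obtain i where "i \<in> {1..p}" "U = H i" by blast
  then show "affine U" using hyperplane_eq affine_hyperplane by metis
qed

lemma inner_normal_span_Inter_diff:
  assumes "x \<in> (\<Inter>i\<in>{1..p}. H i)" "y \<in> (\<Inter>i\<in>{1..p}. H i)" "v \<in> normal_span"
  shows "v \<bullet> (x - y) = 0"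
proof -
  have "orthogonal (x - y) v"
  proof (rule orthogonal_to_span)
    show "v \<in> span (a ` {1..p})" using assms(3) by (simp add: normal_span_def)
    fix u assume "u \<in> a ` {1..p}"
    then obtain i where i: "i \<in> {1..p}" "u = a i" by blast
    then have "x \<in> H i" "y \<in> H i" using assms(1,2) by blast+
    then have "a i \<bullet> x = b i" "a i \<bullet> y = b i" using hyperplane_eq[OF i(1)] by blast+
    with i(2) show "orthogonal (x - y) u"
      by (simp add: orthogonal_def inner_diff_right inner_commute[of _ "a i"])
  qed
  then show ?thesis by (simp add: orthogonal_def inner_commute)
qed

lemma closest_point_Inter:
  assumes "c \<in> (\<Inter>i\<in>{1..p}. H i)" "x - c \<in> normal_span"
  shows "closest_point (\<Inter>i\<in>{1..p}. H i) x = c"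
proof (rule closest_point_affine_eqI[OF affine_Inter_H assms(1)])
  fix y assume "y \<in> (\<Inter>i\<in>{1..p}. H i)"
  then show "(x - c) \<bullet> (y - c) = 0"
    using assms by (intro inner_normal_span_Inter_diff)
qed

text \<open>
  Split \<open>s - w\<close>, for a common point \<open>s\<close>, into its components in \<open>normal_span\<close> and orthogonal to it.
  Subtracting the orthogonal component from \<open>s\<close> does not leave any of the hyperplanes.
\<close>

lemma projection_in_normal_translate:
  assumes "(\<Inter>i\<in>{1..p}. H i) \<noteq> {}"
  obtains c where "c \<in> (\<Inter>i\<in>{1..p}. H i)" "w - c \<in> normal_span"
proof -
  obtain s where s: "s \<in> (\<Inter>i\<in>{1..p}. H i)" using assms by blast
  obtain u v where u: "u \<in> normal_span" and v: "\<And>x. x \<in> normal_span \<Longrightarrow> orthogonal v x"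
    and uv: "s - w = u + v"
    using orthogonal_subspace_decomp_exists[of "a ` {1..p}" "s - w"]
    unfolding normal_span_def by metis
  have "s - v \<in> H i" if i: "i \<in> {1..p}" for i
  proof -
    have "a i \<bullet> s = b i" using s i hyperplane_eq by blast
    moreover have "a i \<bullet> v = 0"
      using v[OF normal_in_normal_span[OF i]] by (simp add: orthogonal_def inner_commute)
    ultimately show ?thesis using hyperplane_eq[OF i] by (simp add: inner_diff_right)
  qed
  moreover have "w - (s - v) = - u" using uv by (simp add: algebra_simps)
  then have "w - (s - v) \<in> normal_span" using u subspace_neg subspace_normal_span by metis
  ultimately show ?thesis using that by blast
qed

text \<open>
  Nondegeneracy at \<open>i\<close> says that the \<open>i\<close>-th reflection really moves the point, so that the
  difference of two consecutive points can be rescaled to \<open>a i\<close>.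
\<close>

lemma affine_hull_reflections:
  assumes "nondegenerate_upto H p w" "v \<in> normal_span"
  shows "w + v \<in> affine hull ((\<lambda>i. reflections H i w) ` {0..p})" (is "_ \<in> affine hull ?X")
proof -
  let ?D = "(+) (- w) ` ?X"
  have diff: "reflections H i w - w \<in> span ?D" if "i \<le> p" for i
    using that by (intro span_base) auto
  have "a i \<in> span ?D" if i: "i \<in> {1..p}" for i
  proof -
    obtain j where j: "i = Suc j" using i by (cases i) auto
    define x where "x = reflections H j w"
    define r where "r = 2 * (a i \<bullet> x - b i) / (a i \<bullet> a i)"
    have "reflection (H i) x \<notin> H i"
      using assms(1) i j unfolding nondegenerate_upto_def x_def by (metis reflections.simps(2))
    then have "r \<noteq> 0"
      using reflection_in_H_iff[OF i] normal_nonzero[OF i] by (simp add: r_def)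
    have "(reflections H j w - w) - (reflections H i w - w) \<in> span ?D"
      using i j by (intro span_diff diff) auto
    moreover have "(reflections H j w - w) - (reflections H i w - w) = r *\<^sub>R a i"
      using reflection_H[OF i, of x] j by (simp add: x_def r_def)
    ultimately have "(1 / r) *\<^sub>R (r *\<^sub>R a i) \<in> span ?D" by (metis span_scale)
    then show ?thesis using \<open>r \<noteq> 0\<close> by simp
  qed
  then have "normal_span \<subseteq> span ?D"
    unfolding normal_span_def by (intro span_minimal) auto
  moreover have "w \<in> affine hull ?X"
    by (rule hull_inc) (rule image_eqI[of _ _ 0], auto)
  then have "affine hull ?X = (+) w ` span ?D" by (rule affine_hull_span_gen)
  ultimately show ?thesis using assms(2) by blast
qed

lemma crm_nondegenerate:
  assumes "nondegenerate_upto H p w" "c \<in> (\<Inter>i\<in>{1..p}. H i)" "w - c \<in> normal_span"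
  shows "crm H p w = c"
proof -
  have hyp: "hyperplane (H i)" if "i \<in> {1..p}" for i
    using normal_nonzero[OF that] hyperplane_eq[OF that] unfolding hyperplane_def by blast
  have "c - w \<in> normal_span"
    using assms(3) subspace_neg[OF subspace_normal_span] by fastforce
  then have "w + (c - w) \<in> affine hull ((\<lambda>i. reflections H i w) ` {0..p})"
    by (rule affine_hull_reflections[OF assms(1)])
  then have "is_circumcenter H p w c"
    using norm_reflections_diff[OF hyp assms(2)] by (simp add: is_circumcenter_def)
  moreover have "\<exists>!c. is_circumcenter H p w c"
    using hyp assms(2) by (intro ex1_circumcenter) blast+
  ultimately show ?thesis unfolding crm_def by (rule the1_equality[rotated])
qed

section \<open>The replacement procedure\<close>

text \<open>
  At \<open>k\<close> itself the displacement is \<open>t\<close> times a normal, which leaves the hyperplane for every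
  \<open>t \<noteq> 0\<close>.  Below \<open>k\<close> the reflected points avoid their hyperplanes at \<open>t = 0\<close>; as hyperplanes are
  closed, this persists for small \<open>t\<close>.
\<close>

lemma eventually_nondegenerate_replacement:
  assumes k: "first_degenerate H p w k" and v: "normal_vector (H k) v"
  shows "\<forall>\<^sub>F t in at 0. nondegenerate_upto H k (replacement H k w v t)"
proof -
  have kp: "k \<in> {1..p}" using k by (simp add: first_degenerate_def)
  let ?L = "\<lambda>i. reflections (\<lambda>i. direction (H i)) i (rev_linear_reflections H k v)"
  have shift: "reflections H i (replacement H k w v t) = reflections H i w + t *\<^sub>R ?L i"
    if "i \<in> {1..k}" for i t
    unfolding replacement_def using that kp by (intro reflections_displaced) auto
  have "\<forall>\<^sub>F t in at 0. reflections H i (replacement H k w v t) \<notin> H i" if i: "i \<in> {1..k}" for i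
  proof (cases "i = k")
    case True
    obtain r where r: "r \<noteq> 0" "v = r *\<^sub>R a k"
      using normal_vector_hyperplane[OF normal_nonzero[OF kp]] v hyperplane_eq[OF kp] by metis
    have "?L k = v" using kp by (intro reflections_rev_linear_reflections) simp
    moreover have "a k \<bullet> reflections H k w = b k"
      using k hyperplane_eq[OF kp] by (auto simp: first_degenerate_def)
    ultimately have "reflections H k (replacement H k w v t) \<notin> H k" if "t \<noteq> 0" for t
      using shift[of k t] kp r that normal_nonzero[OF kp] hyperplane_eq[OF kp]
      by (simp add: inner_add_right)
    then show ?thesis using True eventually_at_topological by blast
  next
    case False
    have ip: "i \<in> {1..p}" using i kp by auto
    have "((\<lambda>t. reflections H i w + t *\<^sub>R ?L i) \<longlongrightarrow> reflections H i w + 0 *\<^sub>R ?L i) (at 0)"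
      by (intro tendsto_intros)
    moreover have "open (- H i)"
      using hyperplane_eq[OF ip] closed_hyperplane[of "a i" "b i"] by (metis open_Compl)
    moreover have "reflections H i w + 0 *\<^sub>R ?L i \<in> - H i"
      using k i False by (auto simp: first_degenerate_def)
    ultimately have "\<forall>\<^sub>F t in at 0. reflections H i w + t *\<^sub>R ?L i \<in> - H i"
      by (rule topological_tendstoD)
    then show ?thesis using shift[OF i] by simp
  qed
  then show ?thesis
    unfolding nondegenerate_upto_def by (intro eventually_ball_finite) auto
qed

lemma ex_first_degenerate:
  assumes "\<not> nondegenerate_upto H p w"
  obtains k where "first_degenerate H p w k"
proof -
  let ?P = "\<lambda>k. k \<in> {1..p} \<and> reflections H k w \<in> H k"
  have "\<exists>k. ?P k" using assms by (auto simp: nondegenerate_upto_def)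
  then have "?P (LEAST k. ?P k)" by (rule LeastI_ex)
  moreover have "\<not> ?P j" if "j < (LEAST k. ?P k)" for j
    using that by (rule not_less_Least)
  ultimately have "first_degenerate H p w (LEAST k. ?P k)"
    unfolding first_degenerate_def by fastforce
  then show ?thesis by (rule that)
qed

lemma first_degenerate_gt:
  assumes "nondegenerate_upto H k w" "first_degenerate H p w j"
  shows "k < j"
proof (rule ccontr)
  assume "\<not> k < j"
  with assms(2) have "j \<in> {1..k}" "reflections H j w \<in> H j"
    by (simp_all add: first_degenerate_def)
  then show False using assms(1) by (simp add: nondegenerate_upto_def)
qed

lemma first_degenerate_unique:
  assumes "first_degenerate H p w j" "first_degenerate H p w k"
  shows "j = k"
proof -
  have "\<not> i < i'" if "first_degenerate H p w i" "first_degenerate H p w i'" for i i'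
    using that by (auto simp: first_degenerate_def)
  with assms show ?thesis by (meson linorder_neqE_nat)
qed

lemma ex_replacement_step:
  assumes "first_degenerate H p w k"
  obtains w' where "replacement_step H p w w'" "nondegenerate_upto H k w'"
proof -
  have k: "k \<in> {1..p}" using assms by (simp add: first_degenerate_def)
  have v: "normal_vector (H k) (a k)"
    using normal_nonzero[OF k]
    by (simp add: normal_vector_def hyperplane_eq[OF k] direction_hyperplane orthogonal_def)
  have "\<forall>\<^sub>F t in at (0::real). t \<noteq> 0" by (rule eventually_neq_at_within)
  with eventually_nondegenerate_replacement[OF assms v]
  have "\<forall>\<^sub>F t in at 0. t \<noteq> 0 \<and> nondegenerate_upto H k (replacement H k w (a k) t)"
    by eventually_elim simp
  then obtain t where "t \<noteq> 0" "nondegenerate_upto H k (replacement H k w (a k) t)"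
    using eventually_happens'[OF at_neq_bot] by blast
  moreover from this have "replacement_step H p w (replacement H k w (a k) t)"
    using assms v unfolding replacement_step_def by blast
  ultimately show ?thesis using that by blast
qed

text \<open>
  Along a run the first degenerate index grows strictly, so after \<open>p\<close> replacements it would
  exceed \<open>p\<close>.
\<close>

lemma no_infinite_replacement:
  "\<nexists>f. f 0 = z \<and> (\<forall>m. replacement_step H p (f m) (f (Suc m)))"
proof
  assume "\<exists>f. f 0 = z \<and> (\<forall>m. replacement_step H p (f m) (f (Suc m)))"
  then obtain f where f: "\<And>m. replacement_step H p (f m) (f (Suc m))" by blast
  have "\<exists>k>m. first_degenerate H p (f m) k" for m
  proof (induction m)
    case 0
    obtain k where "first_degenerate H p (f 0) k"
      using f[of 0] unfolding replacement_step_def by blast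
    moreover from this have "k > 0" by (simp add: first_degenerate_def)
    ultimately show ?case by blast
  next
    case (Suc m)
    then obtain k where k: "m < k" "first_degenerate H p (f m) k" by blast
    obtain i where "first_degenerate H p (f m) i" "nondegenerate_upto H i (f (Suc m))"
      using f[of m] unfolding replacement_step_def by blast
    then have "nondegenerate_upto H k (f (Suc m))"
      using first_degenerate_unique[OF k(2)] by simp
    moreover obtain j where j: "first_degenerate H p (f (Suc m)) j"
      using f[of "Suc m"] unfolding replacement_step_def by blast
    ultimately have "k < j" by (rule first_degenerate_gt)
    with k(1) have "Suc m < j" by simp
    with j show ?case by blast
  qed
  from this[of p] obtain k where "p < k" "first_degenerate H p (f p) k" by blast
  then show False by (simp add: first_degenerate_def)
qed

lemma ex_zrep: "\<exists>y. is_zrep H p w y"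
proof -
  \<comment> \<open>Each replacement enlarges the range \<open>{1..j}\<close> on which nondegeneracy is secured.\<close>
  have "\<exists>y. is_zrep H p w y" if "nondegenerate_upto H j w" for j
    using that
  proof (induction "p - j" arbitrary: j w rule: less_induct)
    case less
    show ?case
    proof (cases "nondegenerate_upto H p w")
      case True
      then show ?thesis unfolding is_zrep_def by blast
    next
      case False
      then obtain k where k: "first_degenerate H p w k" by (rule ex_first_degenerate)
      then obtain w' where w': "replacement_step H p w w'" "nondegenerate_upto H k w'"
        by (rule ex_replacement_step)
      have "j < k" "k \<le> p"
        using first_degenerate_gt[OF less.prems k] k by (auto simp: first_degenerate_def)
      then have "p - k < p - j" by simp
      then obtain y where "is_zrep H p w' y" using less.hyps w'(2) by blast
      then show ?thesis
        using w'(1) unfolding is_zrep_def by (blast intro: converse_rtranclp_into_rtranclp)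
    qed
  qed
  from this[of 0] show ?thesis by (simp add: nondegenerate_upto_def)
qed

lemma is_zrep_nondegenerate:
  assumes "nondegenerate_upto H p w"
  shows "is_zrep H p w y \<longleftrightarrow> y = w"
proof -
  have "\<not> first_degenerate H p w k" for k
    using assms by (auto simp: first_degenerate_def nondegenerate_upto_def)
  then have stop: "\<not> replacement_step H p w x" for x
    by (simp add: replacement_step_def)
  have "y = w" if "(replacement_step H p)\<^sup>*\<^sup>* w y"
    using that by (cases rule: converse_rtranclpE) (simp_all add: stop)
  then show ?thesis
    using assms by (auto simp: is_zrep_def)
qed

lemma zrep_diff_in_normal_span:
  assumes "(replacement_step H p)\<^sup>*\<^sup>* w y"
  shows "w - y \<in> normal_span"
  using assms
proof (induction rule: rtranclp_induct)
  case base
  then show ?case using subspace_0[OF subspace_normal_span] by simp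
next
  case (step y x)
  then obtain k v t where k: "first_degenerate H p y k" and v: "normal_vector (H k) v"
    and x: "x = replacement H k y v t"
    unfolding replacement_step_def by blast
  have kp: "k \<in> {1..p}" using k by (simp add: first_degenerate_def)
  obtain r where "v = r *\<^sub>R a k"
    using normal_vector_hyperplane[OF normal_nonzero[OF kp]] v hyperplane_eq[OF kp] by metis
  then have "v \<in> normal_span"
    using subspace_scale subspace_normal_span normal_in_normal_span[OF kp] by metis
  then have "t *\<^sub>R rev_linear_reflections H k v \<in> normal_span"
    using kp by (intro subspace_scale subspace_normal_span rev_linear_reflections_in_normal_span) auto
  with step.IH have "(w - y) - t *\<^sub>R rev_linear_reflections H k v \<in> normal_span"
    by (rule subspace_diff[OF subspace_normal_span])
  then show ?case by (simp add: x replacement_def algebra_simps)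
qed

text \<open>
  The point of \<open>S\<close> in \<open>y + normal_span\<close> is the circumcenter at \<open>y\<close>; since \<open>w\<close> lies in the same
  translate of \<open>normal_span\<close>, it is also the projection of \<open>w\<close>.
\<close>

lemma crm_zrep:
  assumes "(\<Inter>i\<in>{1..p}. H i) \<noteq> {}" "is_zrep H p w y"
  shows "crm H p y = closest_point (\<Inter>i\<in>{1..p}. H i) w"
proof -
  obtain c where c: "c \<in> (\<Inter>i\<in>{1..p}. H i)" "y - c \<in> normal_span"
    using projection_in_normal_translate[OF assms(1)] .
  have "w - y \<in> normal_span"
    using assms(2) zrep_diff_in_normal_span by (simp add: is_zrep_def)
  then have "(w - y) + (y - c) \<in> normal_span"
    using c(2) by (intro subspace_add subspace_normal_span)
  then have "closest_point (\<Inter>i\<in>{1..p}. H i) w = c"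
    using c(1) by (intro closest_point_Inter) simp_all
  moreover have "crm H p y = c"
    using assms(2) c by (intro crm_nondegenerate) (simp_all add: is_zrep_def)
  ultimately show ?thesis by simp
qed

end

theorem theorem4:
  fixes H :: "nat \<Rightarrow> (real ^ 'n) set" and p :: nat and z :: "real ^ 'n"
  assumes "p \<ge> 1"
    and "\<And>i. i \<in> {1..p} \<Longrightarrow> hyperplane (H i)"
    and "(\<Inter>i\<in>{1..p}. H i) \<noteq> {}"
  shows "(\<forall>w k a. (replacement_step H p)\<^sup>*\<^sup>* z w \<and> first_degenerate H p w k \<and> normal_vector (H k) a \<longrightarrow>
            (\<forall>\<^sub>F t in at 0. nondegenerate_upto H k (replacement H k w a t)))
       \<and> (\<nexists>f. f 0 = z \<and> (\<forall>m. replacement_step H p (f m) (f (Suc m))))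
       \<and> (\<exists>zrep. is_zrep H p z zrep)
       \<and> (nondegenerate_upto H p z \<longrightarrow> (\<forall>zrep. is_zrep H p z zrep \<longleftrightarrow> zrep = z))
       \<and> (\<forall>zrep. is_zrep H p z zrep \<longrightarrow> crm H p zrep = closest_point (\<Inter>i\<in>{1..p}. H i) z)"
proof -
  have "\<forall>i\<in>{1..p}. \<exists>ab. fst ab \<noteq> 0 \<and> H i = {x. fst ab \<bullet> x = snd ab}"
    using assms(2) by (simp add: hyperplane_def)
  then obtain ab where "\<forall>i\<in>{1..p}. fst (ab i) \<noteq> 0 \<and> H i = {x. fst (ab i) \<bullet> x = snd (ab i)}"
    by (rule bchoice[THEN exE])
  then interpret hyperplane_family H p "fst \<circ> ab" "snd \<circ> ab"
    by unfold_locales auto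
  show ?thesis
    by (intro conjI allI impI)
      (simp_all only: eventually_nondegenerate_replacement no_infinite_replacement ex_zrep
        is_zrep_nondegenerate crm_zrep[OF assms(3)] not_False_eq_True)
qed

end
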